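(* Let $X$, $Y$, and $Z$ be Banach spaces, $T\in LR(X,Y)$, and $S\in LR(X,Z)$ with $D(T)\subset D(S)$. If $T$ is closed and $S$ is closable, then $S$ is $T$-bounded.
   Context: All spaces are over the same scalar field ($\mathbf R$ or $\mathbf C$). $LR(X,Y)$ is the set of all linear subspaces of $X\times Y$. For $T\in LR(X,Y)$: $D(T)$ is its domain, $T(x)=\{y\in Y:(x,y)\in T\}$. $\overline T$ is the closure of $T$ in $X\times Y$; $T$ is closed if $\overline T=T$, and closable if $\overline T(x)=T(x)$ for each $x\in D(T)$ (likewise for $S$). For $x\in D(T)$, $\|T(x)\|:=\|[y]\|$ for any $y\in T(x)$, where $[y]=y+\overline{T(0)}\in Y/\overline{T(0)}$ and $\|[y]\|=\inf\{\|y-e\|:e\in\overline{T(0)}\}$ (likewise for $S$). $S$ is $T$-bounded if $D(T)\subset D(S)$ and there is $c\ge0$ with $\|S(x)\|\le c(\|x\|+\|T(x)\|)$ for all $x\in D(T)$. *)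

theory Defs
  imports "HOL-Analysis.Analysis"
begin

text \<open>
  The scalar field is a type \<open>'k\<close> of class \<^class>\<open>real_normed_field\<close>. By the
  Gelfand--Mazur theorem, every such field is isometrically isomorphic to the real or the
  complex numbers, so that quantifying over \<open>'k\<close> means exactly ``real or complex scalars''.
  As the class \<^class>\<open>banach\<close> only knows multiplication by real scalars, multiplication by
  elements of \<open>'k\<close> is an explicit operation.
\<close>

locale normed_space_over = vector_space scale
  for scale :: "'k::real_normed_field \<Rightarrow> 'v::real_normed_vector \<Rightarrow> 'v" +
  assumes norm_scale: "norm (scale a x) = norm a * norm x"
begin

text \<open>Compatibility with the real scalar multiplication of the type is automatic.\<close>

lemma scale_of_real: "scale (of_real r) x = r *\<^sub>R x"
proof -
  let ?f = "\<lambda>r::real. scale (of_real r) x"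
  let ?g = "\<lambda>r::real. ?f r - r *\<^sub>R x"
  have add: "?f (r + s) = ?f r + ?f s" for r s
    by (simp add: scale_left_distrib)
  have gadd: "?g (r + s) = ?g r + ?g s" for r s
    unfolding add by (simp add: algebra_simps)
  have gnat: "?g (of_nat n * r) = of_nat n *\<^sub>R ?g r" for n r
  proof (induction n)
    case 0
    show ?case by simp
  next
    case (Suc n)
    have "?g (of_nat (Suc n) * r) = ?g (r + of_nat n * r)"
      by (simp add: algebra_simps)
    also have "\<dots> = ?g r + of_nat n *\<^sub>R ?g r"
      by (simp only: gadd Suc)
    finally show ?case
      by (simp add: scaleR_add_left)
  qed
  have gint: "?g (of_nat n) = 0" for n
    using gnat[of n 1] by simp
  have gnonneg: "?g r = 0" if "r \<ge> 0" for r
  proof (rule ccontr)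
    assume nz: "?g r \<noteq> 0"
    have bound: "norm (?g s) \<le> 2 * norm x" if "0 \<le> s" "s \<le> 1" for s
    proof -
      have "norm (?g s) \<le> norm (?f s) + norm (s *\<^sub>R x)"
        by (rule norm_triangle_ineq4)
      also have "\<dots> = 2 * (s * norm x)"
        using that by (simp add: norm_scale)
      also have "\<dots> \<le> 2 * norm x"
        using that by (simp add: mult_left_le_one_le)
      finally show ?thesis .
    qed
    obtain n :: nat where n: "2 * norm x < of_nat n * norm (?g r)"
      using reals_Archimedean3[of "norm (?g r)"] nz by auto
    define t where "t = of_nat n * r"
    define m where "m = nat \<lfloor>t\<rfloor>"
    have t0: "t \<ge> 0" using that by (simp add: t_def)
    have m: "of_nat m \<le> t" "t - of_nat m \<le> 1"
      using t0 by (simp_all add: m_def) linarith+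
    have "?g t = ?g (of_nat m + (t - of_nat m))"
      by simp
    also have "\<dots> = ?g (t - of_nat m)"
      by (simp only: gadd gint add_0)
    finally have "norm (?g t) \<le> 2 * norm x"
      using bound[of "t - of_nat m"] m by simp
    moreover have "norm (?g t) = of_nat n * norm (?g r)"
      unfolding t_def gnat by simp
    ultimately show False using n by simp
  qed
  have "?g r = 0"
  proof (cases "r \<ge> 0")
    case True
    then show ?thesis by (rule gnonneg)
  next
    case False
    have "?g r + ?g (- r) = 0"
      using gadd[of r "- r"] by simp
    moreover have "?g (- r) = 0"
      using False by (intro gnonneg) simp
    ultimately show ?thesis by (metis add.right_neutral)
  qed
  then show ?thesis by simp
qed

end

lemma normed_space_over_real: "normed_space_over ((*\<^sub>R) :: real \<Rightarrow> 'v \<Rightarrow> 'v::real_normed_vector)"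
  by unfold_locales (simp_all add: algebra_simps)

lemma normed_space_over_self: "normed_space_over ((*) :: 'k \<Rightarrow> 'k \<Rightarrow> 'k::real_normed_field)"
  by unfold_locales (simp_all add: algebra_simps norm_mult)

text \<open>The domain of \<open>T\<close> is \<^term>\<open>Domain T\<close>, and \<open>T(x)\<close> is \<^term>\<open>T `` {x}\<close>.\<close>

definition LR ::
  "('k::field \<Rightarrow> 'x::ab_group_add \<Rightarrow> 'x) \<Rightarrow> ('k \<Rightarrow> 'y::ab_group_add \<Rightarrow> 'y) \<Rightarrow> ('x \<times> 'y) set set"
  where "LR scaleX scaleY = {T. module.subspace (module_prod.scale scaleX scaleY) T}"

definition lr_closable :: "('x::topological_space \<times> 'y::topological_space) set \<Rightarrow> bool"
  where "lr_closable T \<longleftrightarrow> (\<forall>x \<in> Domain T. closure T `` {x} = T `` {x})"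

definition coset_norm :: "'y::real_normed_vector set \<Rightarrow> 'y \<Rightarrow> real"
  where "coset_norm E y = (INF e \<in> E. norm (y - e))"

definition lr_norm :: "('x::zero \<times> 'y::real_normed_vector) set \<Rightarrow> 'x \<Rightarrow> real"
  where "lr_norm T x = coset_norm (closure (T `` {0})) (SOME y. y \<in> T `` {x})"

definition relatively_bounded ::
  "('x::real_normed_vector \<times> 'z::real_normed_vector) set \<Rightarrow> ('x \<times> 'y::real_normed_vector) set \<Rightarrow> bool"
  where "relatively_bounded S T \<longleftrightarrow> Domain T \<subseteq> Domain S \<and>
    (\<exists>c\<ge>0. \<forall>x \<in> Domain T. lr_norm S x \<le> c * (norm x + lr_norm T x))"

lemma LR_D:
  assumes "normed_space_over scaleX" "normed_space_over scaleY" "T \<in> LR scaleX scaleY"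
  shows LR_zero: "(0, 0) \<in> T"
    and LR_add: "(x, y) \<in> T \<Longrightarrow> (x', y') \<in> T \<Longrightarrow> (x + x', y + y') \<in> T"
    and LR_scale: "(x, y) \<in> T \<Longrightarrow> (scaleX a x, scaleY a y) \<in> T"
proof -
  interpret X: normed_space_over scaleX by fact
  interpret Y: normed_space_over scaleY by fact
  interpret P: vector_space_prod scaleX scaleY ..
  have T: "P.p.subspace T" using assms(3) by (simp add: LR_def)
  show "(0, 0) \<in> T" using P.p.subspace_0[OF T] by (simp add: zero_prod_def)
  show "(x, y) \<in> T \<Longrightarrow> (x', y') \<in> T \<Longrightarrow> (x + x', y + y') \<in> T"
    using P.p.subspace_add[OF T, of "(x, y)" "(x', y')"] by simp
  show "(x, y) \<in> T \<Longrightarrow> (scaleX a x, scaleY a y) \<in> T"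
    using P.p.subspace_scale[OF T, of "(x, y)" a] by (simp add: P.scale_prod)
qed

lemma subspace_closure_normed:
  fixes V :: "'v::real_normed_vector set"
  assumes V: "subspace V"
  shows "subspace (closure V)"
  unfolding subspace_def
proof (intro conjI ballI allI)
  show "0 \<in> closure V"
    using subspace_0[OF V] closure_subset by blast
  show "x + y \<in> closure V" if x: "x \<in> closure V" and y: "y \<in> closure V" for x y
  proof -
    obtain f g where "\<And>n. f n \<in> V" "f \<longlonglongrightarrow> x" "\<And>n. g n \<in> V" "g \<longlonglongrightarrow> y"
      using x y unfolding closure_sequential by blast
    then have "\<forall>n. f n + g n \<in> V" "(\<lambda>n. f n + g n) \<longlonglongrightarrow> x + y"
      by (auto intro: subspace_add[OF V] tendsto_add)
    then show ?thesis unfolding closure_sequential by (intro exI conjI)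
  qed
  show "c *\<^sub>R x \<in> closure V" if x: "x \<in> closure V" for c x
  proof -
    obtain f where "\<And>n. f n \<in> V" "f \<longlonglongrightarrow> x"
      using x unfolding closure_sequential by blast
    then have "\<forall>n. c *\<^sub>R f n \<in> V" "(\<lambda>n. c *\<^sub>R f n) \<longlonglongrightarrow> c *\<^sub>R x"
      by (auto intro: subspace_scale[OF V] tendsto_intros)
    then show ?thesis unfolding closure_sequential by (intro exI conjI)
  qed
qed

text \<open>The choice of \<open>y \<in> T(x)\<close> in \<^const>\<open>lr_norm\<close> is immaterial.\<close>

lemma lr_norm_eq:
  assumes X: "normed_space_over scaleX" and Y: "normed_space_over scaleY"
    and T: "T \<in> LR scaleX scaleY" and xy: "(x, y) \<in> T"
  shows "lr_norm T x = coset_norm (closure (T `` {0})) y"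
proof -
  interpret X: normed_space_over scaleX by fact
  interpret Y: normed_space_over scaleY by fact
  let ?E = "closure (T `` {0})"
  define y' where "y' = (SOME y. y \<in> T `` {x})"
  have y': "(x, y') \<in> T"
    unfolding y'_def using someI[of "\<lambda>y. y \<in> T `` {x}" y] xy by simp
  have diff: "(u - u', v - v') \<in> T" if "(u, v) \<in> T" "(u', v') \<in> T" for u u' v v'
    using LR_add[OF X Y T that(1) LR_scale[OF X Y T that(2), of "-1"]] by simp
  have "subspace (T `` {0})"
    using LR_zero[OF X Y T] LR_add[OF X Y T, of 0 _ 0] LR_scale[OF X Y T, of 0 _ "of_real _"]
    by (auto simp: subspace_def Y.scale_of_real)
  then have E: "subspace ?E" by (rule subspace_closure_normed)
  have d: "y - y' \<in> ?E"
    using diff[OF xy y'] closure_subset[of "T `` {0}"] by auto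
  have "(\<lambda>e. norm (y' - e)) ` ?E = (\<lambda>e. norm (y - e)) ` ?E"
  proof (intro equalityI image_subsetI)
    fix e assume "e \<in> ?E"
    then show "norm (y' - e) \<in> (\<lambda>e. norm (y - e)) ` ?E"
      using subspace_add[OF E _ d, of e] by (intro image_eqI[of _ _ "e + (y - y')"]) auto
  next
    fix e assume "e \<in> ?E"
    then show "norm (y - e) \<in> (\<lambda>e. norm (y' - e)) ` ?E"
      using subspace_diff[OF E _ d, of e] by (intro image_eqI[of _ _ "e - (y - y')"]) auto
  qed
  then show ?thesis
    by (simp add: lr_norm_def coset_norm_def y'_def)
qed

end

theory Submission
  imports Defs
begin

text \<open>
  The statement is a closed graph theorem for linear relations. Since \<open>T\<close> is closed, it is itself
  a Banach space under the norm of \<open>X \<times> Y\<close>, and the linear relation \<open>R\<close> that sends a pair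
  \<open>(x, y) \<in> T\<close> to the elements of \<open>S(x)\<close> is defined on all of it. Closability of \<open>S\<close>, together with
  \<open>D(T) \<subseteq> D(S)\<close>, makes the graph of this relation closed over \<open>T\<close>.
  By the Baire category theorem, the closure of some sublevel set
  \<open>{g \<in> T. \<exists>z. (g, z) \<in> R \<and> \<parallel>z\<parallel> \<le> n}\<close> has interior points relative to \<open>T\<close>
  (\<open>closed_relation_approx\<close>). Successive approximation then removes the closure
  (\<open>closed_relation_bounded\<close>): there is \<open>c\<close> such that every \<open>(x, y) \<in> T\<close> admits some \<open>z \<in> S(x)\<close>
  with \<open>\<parallel>z\<parallel> \<le> c \<parallel>(x, y)\<parallel> \<le> c (\<parallel>x\<parallel> + \<parallel>y\<parallel>)\<close>. As \<open>z\<close> only bounds \<open>\<parallel>S(x)\<parallel>\<close> from above, while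
  \<open>y\<close> ranges over all of \<open>T(x)\<close>, taking the infimum over \<open>y\<close> turns \<open>\<parallel>y\<parallel>\<close> into \<open>\<parallel>T(x)\<parallel>\<close>.
\<close>

text \<open>
  Baire's theorem yields a relative ball of \<open>V\<close> around some \<open>g0\<close> inside the closure of a sublevel
  set. Sublevel sets are symmetric and convex, so half the difference of approximants of
  \<open>g0 + h\<close> and \<open>g0 - h\<close> approximates \<open>h\<close>: the ball may be centred at the origin, and homogeneity
  extends the estimate from the ball to \<open>V\<close>.
\<close>

lemma closed_relation_approx:
  fixes V :: "'a::banach set" and R :: "('a \<times> 'b::real_normed_vector) set"
  assumes V: "subspace V" "closed V" and R: "subspace R" and dom: "V \<subseteq> Domain R"
  shows "\<exists>C\<ge>0. \<forall>h\<in>V. \<forall>e>0. \<exists>a z. a \<in> V \<and> (a, z) \<in> R \<and> norm z \<le> C * norm h \<and> norm (h - a) < e"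
proof -
  define A where "A n = {g\<in>V. \<exists>z. (g, z) \<in> R \<and> norm z \<le> real n}" for n
  have Asub: "closure (A n) \<subseteq> V" for n
    by (rule closure_minimal) (use V in \<open>auto simp: A_def\<close>)
  have "V \<subseteq> (\<Union>n. closure (A n))"
  proof
    fix g assume g: "g \<in> V"
    then obtain z where z: "(g, z) \<in> R" using dom by blast
    obtain n :: nat where "norm z \<le> real n" using real_arch_simple by blast
    then have "g \<in> A n" using g z by (auto simp: A_def)
    then show "g \<in> (\<Union>n. closure (A n))" using closure_subset by blast
  qed
  then have V_eq: "\<Union> (range (\<lambda>n. closure (A n))) = V" using Asub by blast
  have "\<exists>n. top_of_set V interior_of closure (A n) \<noteq> {}"
  proof (rule ccontr)
    assume none: "\<not> ?thesis"
    have "top_of_set V interior_of \<Union> (range (\<lambda>n. closure (A n))) = {}"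
    proof (rule Baire_category_alt)
      show "completely_metrizable_space (top_of_set V) \<or>
          locally_compact_space (top_of_set V) \<and> regular_space (top_of_set V)"
        using completely_metrizable_space_closedin[OF completely_metrizable_space_euclidean] V
        by auto
      show "countable (range (\<lambda>n. closure (A n)))" by simp
      show "closedin (top_of_set V) K \<and> top_of_set V interior_of K = {}"
        if "K \<in> range (\<lambda>n. closure (A n))" for K
        using that none Asub by (auto intro!: closed_subset)
    qed
    then show False
      using V_eq interior_of_topspace[of "top_of_set V"] subspace_0[OF V(1)] by auto
  qed
  then obtain n g0 where "g0 \<in> top_of_set V interior_of closure (A n)" by blast
  then obtain U where U: "openin (top_of_set V) U" "g0 \<in> U" "U \<subseteq> closure (A n)"
    unfolding interior_of_def by blast
  then have g0: "g0 \<in> V" using Asub by blast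
  obtain r where r: "r > 0" "ball g0 r \<inter> V \<subseteq> closure (A n)"
    using U openin_contains_ball[of V U] by blast
  have small: "\<exists>a z. a \<in> V \<and> (a, z) \<in> R \<and> norm z \<le> real n \<and> norm (h - a) < e"
    if h: "h \<in> V" "norm h < r" and e: "e > 0" for h e
  proof -
    have "g0 + h \<in> closure (A n)" "g0 - h \<in> closure (A n)"
      using r(2) h g0 subspace_add[OF V(1)] subspace_diff[OF V(1)]
      by (auto simp: dist_norm subset_iff)
    then obtain a b where a: "a \<in> A n" "dist a (g0 + h) < e" and b: "b \<in> A n" "dist b (g0 - h) < e"
      using e unfolding closure_approachable by blast
    obtain za zb where z: "(a, za) \<in> R" "norm za \<le> real n" "(b, zb) \<in> R" "norm zb \<le> real n"
      using a b by (auto simp: A_def)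
    have "(1/2) *\<^sub>R ((a, za) - (b, zb)) \<in> R"
      using z R by (intro subspace_scale subspace_diff)
    moreover have "(1/2) *\<^sub>R (a - b) \<in> V"
      using a b V(1) by (intro subspace_scale subspace_diff) (auto simp: A_def)
    moreover have "norm ((1/2) *\<^sub>R (za - zb)) \<le> real n"
      using norm_triangle_ineq4[of za zb] z by simp
    moreover have "norm (h - (1/2) *\<^sub>R (a - b)) < e"
    proof -
      have "h - (1/2) *\<^sub>R (a - b) = (1/2) *\<^sub>R (((g0 + h) - a) - ((g0 - h) - b))"
        by (simp add: algebra_simps flip: scaleR_2)
      also have "norm \<dots> < e"
        using norm_triangle_ineq4[of "(g0 + h) - a" "(g0 - h) - b"] a(2) b(2)
        by (simp add: dist_norm norm_minus_commute)
      finally show ?thesis .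
    qed
    ultimately show ?thesis
      by (intro exI[of _ "(1/2) *\<^sub>R (a - b)"] exI[of _ "(1/2) *\<^sub>R (za - zb)"]) simp
  qed
  show ?thesis
  proof (intro exI[of _ "2 * real n / r"] conjI ballI allI impI)
    show "0 \<le> 2 * real n / r" using r by simp
    fix h and e :: real assume h: "h \<in> V" and e: "e > 0"
    show "\<exists>a z. a \<in> V \<and> (a, z) \<in> R \<and> norm z \<le> 2 * real n / r * norm h \<and> norm (h - a) < e"
    proof (cases "h = 0")
      case True
      then show ?thesis
        using subspace_0[OF R] subspace_0[OF V(1)] e
        by (intro exI[of _ 0]) (simp add: zero_prod_def)
    next
      case False
      define t where "t = r / (2 * norm h)"
      have t: "t > 0" using False r by (simp add: t_def)
      have "norm (t *\<^sub>R h) < r" using False r by (simp add: t_def)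
      then obtain a z where az: "a \<in> V" "(a, z) \<in> R" "norm z \<le> real n" "norm (t *\<^sub>R h - a) < t * e"
        using small[of "t *\<^sub>R h" "t * e"] subspace_scale[OF V(1) h] t e by auto
      have "(1/t) *\<^sub>R (a, z) \<in> R" by (rule subspace_scale[OF R az(2)])
      moreover have "(1/t) *\<^sub>R a \<in> V" by (rule subspace_scale[OF V(1) az(1)])
      moreover have "norm ((1/t) *\<^sub>R z) \<le> 2 * real n / r * norm h"
      proof -
        have "norm ((1/t) *\<^sub>R z) = (1/t) * norm z" using t by simp
        also have "\<dots> \<le> (1/t) * real n" using t az(3) by (intro mult_left_mono) auto
        also have "\<dots> = 2 * real n / r * norm h" by (simp add: t_def)
        finally show ?thesis .
      qed
      moreover have "norm (h - (1/t) *\<^sub>R a) < e"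
      proof -
        have "h - (1/t) *\<^sub>R a = (1/t) *\<^sub>R (t *\<^sub>R h - a)"
          using t by (simp add: scaleR_diff_right)
        also have "norm \<dots> = norm (t *\<^sub>R h - a) / t" using t by simp
        also have "\<dots> < e" using az(4) t by (simp add: pos_divide_less_eq mult.commute)
        finally show ?thesis .
      qed
      ultimately show ?thesis
        by (intro exI[of _ "(1/t) *\<^sub>R a"] exI[of _ "(1/t) *\<^sub>R z"]) simp
    qed
  qed
qed

text \<open>
  A closed graph theorem for relations. The remainder of each approximation has at most half the
  previous norm, so the corresponding values are dominated by a geometric series and sum to some
  \<open>z\<close>. Closedness is what places the limit \<open>(g, z)\<close> back into \<open>R\<close>. It is asked for over \<open>V\<close> alone,
  since closability of a relation controls its closure only over its own domain.
\<close>

lemma closed_relation_bounded: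
  fixes V :: "'a::banach set" and R :: "('a \<times> 'b::banach) set"
  assumes V: "subspace V" "closed V" and R: "subspace R" and dom: "V \<subseteq> Domain R"
    and cl: "\<And>g z. g \<in> V \<Longrightarrow> (g, z) \<in> closure R \<Longrightarrow> (g, z) \<in> R"
  shows "\<exists>c\<ge>0. \<forall>g\<in>V. \<exists>z. (g, z) \<in> R \<and> norm z \<le> c * norm g"
proof -
  obtain C where C: "C \<ge> 0" and approx: "\<And>h e. h \<in> V \<Longrightarrow> e > 0 \<Longrightarrow>
      \<exists>a z. a \<in> V \<and> (a, z) \<in> R \<and> norm z \<le> C * norm h \<and> norm (h - a) < e"
    using closed_relation_approx[OF V R dom] by metis
  have "\<exists>a z. a \<in> V \<and> (a, z) \<in> R \<and> norm z \<le> C * norm h \<and> norm (h - a) \<le> norm h / 2"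
    if h: "h \<in> V" for h
  proof (cases "h = 0")
    case True
    then show ?thesis
      using subspace_0[OF R] subspace_0[OF V(1)]
      by (intro exI[of _ 0]) (simp add: zero_prod_def)
  next
    case False
    then show ?thesis using approx[OF h, of "norm h / 2"] by (force intro: less_imp_le)
  qed
  then obtain a z where step: "\<And>h. h \<in> V \<Longrightarrow>
      a h \<in> V \<and> (a h, z h) \<in> R \<and> norm (z h) \<le> C * norm h \<and> norm (h - a h) \<le> norm h / 2"
    by metis
  have "\<exists>z. (g, z) \<in> R \<and> norm z \<le> (2 * C) * norm g" if g: "g \<in> V" for g
  proof -
    define h where "h k = ((\<lambda>u. u - a u) ^^ k) g" for k
    have h0: "h 0 = g" and hS: "h (Suc k) = h k - a (h k)" for k
      by (simp_all add: h_def)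
    have hV: "h k \<in> V" for k
      by (induction k) (use g step subspace_diff[OF V(1)] in \<open>auto simp: h0 hS\<close>)
    have hn: "norm (h k) \<le> norm g * (1/2) ^ k" for k
    proof (induction k)
      case 0
      show ?case by (simp add: h0)
    next
      case (Suc k)
      then show ?case using step[OF hV[of k]] by (simp add: hS)
    qed
    have zn: "norm (z (h k)) \<le> C * norm g * (1/2) ^ k" for k
      using step[OF hV[of k]] mult_left_mono[OF hn[of k] C] by (simp add: mult.assoc)
    have geo: "(\<lambda>k. C * norm g * (1/2) ^ k) sums (2 * C * norm g)"
      using sums_mult[OF geometric_sums[of "1/2::real"], of "C * norm g"] by (simp add: mult_ac)
    have sumn: "summable (\<lambda>k. norm (z (h k)))"
      by (rule summable_comparison_test[OF _ sums_summable[OF geo]]) (use zn in auto)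
    have "norm (\<Sum>k. z (h k)) \<le> (\<Sum>k. norm (z (h k)))"
      by (rule summable_norm[OF sumn])
    also have "\<dots> \<le> (\<Sum>k. C * norm g * (1/2) ^ k)"
      by (rule suminf_le[OF zn sumn sums_summable[OF geo]])
    also have "\<dots> = 2 * C * norm g" using geo by (rule sums_unique[symmetric])
    finally have bound: "norm (\<Sum>k. z (h k)) \<le> 2 * C * norm g" .
    have part: "(g - h k, \<Sum>i<k. z (h i)) \<in> R" for k
    proof (induction k)
      case 0
      show ?case using subspace_0[OF R] by (simp add: h0 zero_prod_def)
    next
      case (Suc k)
      then show ?case
        using subspace_add[OF R Suc, of "(a (h k), z (h k))"] step[OF hV[of k]]
        by (simp add: hS algebra_simps)
    qed
    have "(\<lambda>k. norm g * (1/2) ^ k) \<longlonglongrightarrow> 0"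
      by (intro tendsto_mult_right_zero LIMSEQ_realpow_zero) auto
    then have "h \<longlonglongrightarrow> 0"
      by (rule Lim_null_comparison[rotated]) (simp add: hn)
    then have "(\<lambda>k. (g - h k, \<Sum>i<k. z (h i))) \<longlonglongrightarrow> (g - 0, \<Sum>k. z (h k))"
      by (intro tendsto_Pair tendsto_intros summable_LIMSEQ summable_norm_cancel[OF sumn])
    then have "(g, \<Sum>k. z (h k)) \<in> closure R"
      using part unfolding closure_sequential by force
    then show ?thesis using cl[OF g] bound by blast
  qed
  then show ?thesis using C by (intro exI[of _ "2 * C"]) auto
qed

lemma LR_subspace:
  assumes X: "normed_space_over scaleX" and Y: "normed_space_over scaleY"
    and T: "T \<in> LR scaleX scaleY"
  shows "subspace T"
  unfolding subspace_def
proof (intro conjI ballI allI)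
  show "0 \<in> T" using LR_zero[OF X Y T] by (simp add: zero_prod_def)
  show "p + q \<in> T" if "p \<in> T" "q \<in> T" for p q
    using LR_add[OF X Y T, of "fst p" "snd p" "fst q" "snd q"] that by (simp add: plus_prod_def)
  show "c *\<^sub>R p \<in> T" if "p \<in> T" for c p
    using LR_scale[OF X Y T, of "fst p" "snd p" "of_real c"] that
    by (simp add: normed_space_over.scale_of_real[OF X] normed_space_over.scale_of_real[OF Y]
        scaleR_prod_def)
qed

theorem theorem6p2:
  fixes scaleX :: "'k::real_normed_field \<Rightarrow> 'x::banach \<Rightarrow> 'x"
    and scaleY :: "'k \<Rightarrow> 'y::banach \<Rightarrow> 'y"
    and scaleZ :: "'k \<Rightarrow> 'z::banach \<Rightarrow> 'z"
    and T :: "('x \<times> 'y) set"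
    and S :: "('x \<times> 'z) set"
  assumes "normed_space_over scaleX" and "normed_space_over scaleY" and "normed_space_over scaleZ"
    and "T \<in> LR scaleX scaleY" and "S \<in> LR scaleX scaleZ"
    and "Domain T \<subseteq> Domain S"
    and "closed T" and "lr_closable S"
  shows "relatively_bounded S T"
proof -
  note T = assms(1,2,4) and S = assms(1,3,5)
  have subT: "subspace T" and subS: "subspace S"
    using LR_subspace[OF T] LR_subspace[OF S] .
  define R where "R = {((x, y), z). (x, y) \<in> T \<and> (x, z) \<in> S}"
  have "subspace R"
    using subspace_0[OF subT] subspace_0[OF subS] subspace_add[OF subT] subspace_add[OF subS]
      subspace_scale[OF subT] subspace_scale[OF subS]
    unfolding subspace_def R_def by (fastforce simp: zero_prod_def)
  moreover have "T \<subseteq> Domain R"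
    using assms(6) by (fastforce simp: R_def)
  moreover have "(g, z) \<in> R" if g: "g \<in> T" and gz: "(g, z) \<in> closure R" for g z
  proof -
    obtain f where f: "\<And>n. f n \<in> R" "f \<longlonglongrightarrow> (g, z)"
      using gz unfolding closure_sequential by blast
    have "(\<lambda>n. (fst (fst (f n)), snd (f n))) \<longlonglongrightarrow> (fst (fst (g, z)), snd (g, z))"
      using f(2) by (intro tendsto_Pair tendsto_fst tendsto_snd)
    moreover have "(fst (fst (f n)), snd (f n)) \<in> S" for n
      using f(1)[of n] by (auto simp: R_def)
    ultimately have "(fst g, z) \<in> closure S"
      unfolding closure_sequential by force
    moreover have "fst g \<in> Domain S"
      using g assms(6) by (cases g) auto
    ultimately have "(fst g, z) \<in> S"
      using assms(8) unfolding lr_closable_def by blast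
    then show ?thesis using g by (auto simp: R_def)
  qed
  ultimately obtain c where c: "c \<ge> 0"
    and bound: "\<And>g. g \<in> T \<Longrightarrow> \<exists>z. (g, z) \<in> R \<and> norm z \<le> c * norm g"
    using closed_relation_bounded[OF subT assms(7), of R] by blast
  have "lr_norm S x \<le> c * (norm x + lr_norm T x)" if x: "x \<in> Domain T" for x
  proof -
    obtain y where y: "(x, y) \<in> T" using x by blast
    \<comment> \<open>\<open>y - e\<close> runs through \<open>T(x)\<close> as \<open>e\<close> runs through \<open>T(0)\<close>, which is closed because \<open>T\<close> is.\<close>
    have T0: "(x, y - e) \<in> T" if e: "e \<in> closure (T `` {0})" for e
    proof -
      have "T `` {0} = Pair 0 -` T" by auto
      then have "closed (T `` {0})"
        using assms(7) by (simp add: closed_vimage continuous_intros)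
      then have "(0, e) \<in> T" using e by simp
      then show ?thesis using subspace_diff[OF subT y, of "(0, e)"] by simp
    qed
    have est: "lr_norm S x \<le> c * norm x + c * norm (y - e)" if e: "e \<in> closure (T `` {0})" for e
    proof -
      obtain z where z: "(x, z) \<in> S" "norm z \<le> c * norm (x, y - e)"
        using bound[OF T0[OF e]] by (auto simp: R_def)
      have 0: "0 \<in> closure (S `` {0})"
        using LR_zero[OF S] closure_subset by blast
      have "lr_norm S x = coset_norm (closure (S `` {0})) z"
        by (rule lr_norm_eq[OF S z(1)])
      also have "\<dots> \<le> norm (z - 0)"
        unfolding coset_norm_def by (rule cINF_lower[OF bdd_belowI2[of _ 0] 0]) simp
      also have "\<dots> \<le> c * norm (x, y - e)" using z(2) by simp
      also have "\<dots> \<le> c * (norm x + norm (y - e))"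
        by (intro mult_left_mono norm_Pair_le c)
      finally show ?thesis by (simp add: distrib_left)
    qed
    have 0: "0 \<in> closure (T `` {0})"
      using LR_zero[OF T] closure_subset by blast
    show ?thesis
    proof (cases "c = 0")
      case True
      then show ?thesis using est[OF 0] by simp
    next
      case False
      then have pos: "c > 0" using c by simp
      have "(lr_norm S x - c * norm x) / c \<le> coset_norm (closure (T `` {0})) y"
        unfolding coset_norm_def
        by (rule cINF_greatest) (use 0 est pos in \<open>auto simp: pos_divide_le_eq algebra_simps\<close>)
      then show ?thesis
        using pos by (simp add: lr_norm_eq[OF T y] pos_divide_le_eq algebra_simps)
    qed
  qed
  then show ?thesis
    unfolding relatively_bounded_def using assms(6) c by blast
qed

end
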